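(* Let $(B^H_t)_{t\ge0}$ be a fractional Brownian motion with Hurst parameter $H\in(0,1)$, let $a\in\mathbb{R}$ and let $\alpha>1$. For each integer $N\ge1$, let $Y_j=j\frac aN+B^H_{j/N}$ for $j=1,\dots,N^\alpha$, let $\Gamma=(\Gamma_{i,j})_{i,j=1,\dots,N^\alpha}$ with $\Gamma_{i,j}=\mathrm{Cov}\big(B^H_{i/N},B^H_{j/N}\big)$, and let $\Gamma^{-1}_{i,j}$ denote the entries of the inverse matrix $\Gamma^{-1}$. Then the maximum likelihood estimator $$\hat a_N=N\,\frac{\sum_{i,j=1}^{N^\alpha}j\,\Gamma^{-1}_{i,j}\,Y_i}{\sum_{i,j=1}^{N^\alpha}ij\,\Gamma^{-1}_{i,j}}$$ is strongly consistent, i.e. $\hat a_N-a\to0$ almost surely as $N\to\infty$.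
   Context: Fractional Brownian motion with Hurst parameter $H$ is the centered Gaussian process with covariance $\mathbb{E}(B^H_tB^H_s)=\frac12\left(t^{2H}+s^{2H}-|t-s|^{2H}\right)$. $N^\alpha$ denotes the number of observations and is understood as its integer part $\lfloor N^\alpha\rfloor$ when it is not an integer. *)

theory Defs
  imports "HOL-Probability.Probability" "Jordan_Normal_Form.Gauss_Jordan_Elimination"
begin

definition covariance :: "'a measure \<Rightarrow> ('a \<Rightarrow> real) \<Rightarrow> ('a \<Rightarrow> real) \<Rightarrow> real" where
  "covariance M X Y =
     (\<integral>\<omega>. (X \<omega> - (\<integral>\<omega>'. X \<omega>' \<partial>M)) * (Y \<omega> - (\<integral>\<omega>'. Y \<omega>' \<partial>M)) \<partial>M)"

(* Gaussian laws of variance zero are admitted; they occur, e.g., for B 0 below. *)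
definition gaussian_rv :: "'a measure \<Rightarrow> ('a \<Rightarrow> real) \<Rightarrow> bool" where
  "gaussian_rv M X \<longleftrightarrow> X \<in> borel_measurable M \<and>
     ((\<exists>\<mu> \<sigma>. \<sigma> > 0 \<and> distributed M lborel X (normal_density \<mu> \<sigma>)) \<or>
      (\<exists>\<mu>. AE \<omega> in M. X \<omega> = \<mu>))"

definition gaussian_process :: "'a measure \<Rightarrow> 't set \<Rightarrow> ('t \<Rightarrow> 'a \<Rightarrow> real) \<Rightarrow> bool" where
  "gaussian_process M T X \<longleftrightarrow> prob_space M \<and>
     (\<forall>J c. finite J \<and> J \<subseteq> T \<longrightarrow> gaussian_rv M (\<lambda>\<omega>. \<Sum>t\<in>J. c t * X t \<omega>))"

(* Path continuity is not part of the definition. *)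
definition fractional_brownian_motion ::
    "'a measure \<Rightarrow> real \<Rightarrow> (real \<Rightarrow> 'a \<Rightarrow> real) \<Rightarrow> bool" where
  "fractional_brownian_motion M H B \<longleftrightarrow>
     gaussian_process M {0..} B \<and>
     (\<forall>t\<ge>0. (\<integral>\<omega>. B t \<omega> \<partial>M) = 0) \<and>
     (\<forall>t\<ge>0. \<forall>s\<ge>0. (\<integral>\<omega>. B t \<omega> * B s \<omega> \<partial>M) =
        (t powr (2 * H) + s powr (2 * H) - \<bar>t - s\<bar> powr (2 * H)) / 2)"

definition num_obs :: "real \<Rightarrow> nat \<Rightarrow> nat" where
  "num_obs \<alpha> N = nat \<lfloor>real N powr \<alpha>\<rfloor>"

definition observation ::
    "(real \<Rightarrow> 'a \<Rightarrow> real) \<Rightarrow> real \<Rightarrow> nat \<Rightarrow> nat \<Rightarrow> 'a \<Rightarrow> real" where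
  "observation B a N j \<omega> = real j * (a / real N) + B (real j / real N) \<omega>"

(* Matrix indices start at 0: position (i, j) belongs to the times (i+1)/N and (j+1)/N. *)
definition cov_matrix ::
    "'a measure \<Rightarrow> (real \<Rightarrow> 'a \<Rightarrow> real) \<Rightarrow> real \<Rightarrow> nat \<Rightarrow> real Matrix.mat" where
  "cov_matrix M B \<alpha> N = Matrix.mat (num_obs \<alpha> N) (num_obs \<alpha> N)
     (\<lambda>(i, j). covariance M (B (real (i + 1) / real N)) (B (real (j + 1) / real N)))"

(* Entry (i, j), 1-based, of the inverse; mat_inverse returns None on singular matrices,
   in which case the value is unspecified. *)
definition cov_inverse ::
    "'a measure \<Rightarrow> (real \<Rightarrow> 'a \<Rightarrow> real) \<Rightarrow> real \<Rightarrow> nat \<Rightarrow> nat \<Rightarrow> nat \<Rightarrow> real" where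
  "cov_inverse M B \<alpha> N i j = the (mat_inverse (cov_matrix M B \<alpha> N)) $$ (i - 1, j - 1)"

definition drift_mle ::
    "'a measure \<Rightarrow> (real \<Rightarrow> 'a \<Rightarrow> real) \<Rightarrow> real \<Rightarrow> real \<Rightarrow> nat \<Rightarrow> 'a \<Rightarrow> real" where
  "drift_mle M B a \<alpha> N \<omega> = real N *
     ((\<Sum>i=1..num_obs \<alpha> N. \<Sum>j=1..num_obs \<alpha> N.
         real j * cov_inverse M B \<alpha> N i j * observation B a N i \<omega>) /
      (\<Sum>i=1..num_obs \<alpha> N. \<Sum>j=1..num_obs \<alpha> N.
         real i * real j * cov_inverse M B \<alpha> N i j))"

end

theory Submission
  imports Defs "Jordan_Normal_Form.Determinant"
begin

text \<open>Write \<open>u = (1, \<dots>, n)\<close> with \<open>n = \<lfloor>N\<^sup>\<alpha>\<rfloor>\<close>. The error is the centered Gaussian variable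
  \<open>N (u\<^sup>T \<Gamma>\<^sup>-\<^sup>1 B) / (u\<^sup>T \<Gamma>\<^sup>-\<^sup>1 u)\<close>, of variance \<open>N\<^sup>2 / (u\<^sup>T \<Gamma>\<^sup>-\<^sup>1 u)\<close>. By Cauchy--Schwarz this is at
  most the variance \<open>(n / N)\<^bsup>2H-2\<^esup>\<close> of the unbiased estimator \<open>Y\<^sub>n N / n\<close>, hence of order
  \<open>N\<^bsup>-(\<alpha>-1)(2-2H)\<^esup>\<close>. Gaussian moments of high order are therefore summable over \<open>N\<close>, which gives
  almost sure convergence. Invertibility of \<open>\<Gamma>\<close> comes from the representation
  \<open>K \<bar>t\<bar>\<^bsup>2H\<^esup> = \<integral> (1 - cos (t x)) x\<^bsup>-1-2H\<^esup> dx\<close> over the positive half-line: on a vector in the kernel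
  a trigonometric polynomial vanishes almost everywhere, so all its coefficients are zero.\<close>

section \<open>Spectral representation of the covariance\<close>

definition fbm_kernel :: "real \<Rightarrow> real \<Rightarrow> real \<Rightarrow> real" where
  "fbm_kernel H t s = (t powr (2 * H) + s powr (2 * H) - \<bar>t - s\<bar> powr (2 * H)) / 2"

text \<open>The spectral density of fractional Brownian motion up to a constant factor. The
  half-line suffices because \<open>1 - cos (t * x)\<close> is even in \<open>x\<close>.\<close>

definition spectral_weight :: "real \<Rightarrow> real \<Rightarrow> real" where
  "spectral_weight H x = indicator {0<..} x * x powr (- 1 - 2 * H)"

lemma spectral_weight_nonneg: "0 \<le> spectral_weight H x"
  by (simp add: spectral_weight_def)

lemma spectral_weight_pos: "0 < x \<Longrightarrow> 0 < spectral_weight H x"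
  by (simp add: spectral_weight_def)

lemma spectral_weight_measurable [measurable]: "spectral_weight H \<in> borel_measurable borel"
  unfolding spectral_weight_def by measurable

lemma one_minus_cos_le: "1 - cos x \<le> x\<^sup>2 / 2" for x :: real
proof -
  have "\<bar>sin (x / 2)\<bar>\<^sup>2 \<le> \<bar>x / 2\<bar>\<^sup>2"
    by (intro power_mono abs_sin_x_le_abs_x) auto
  then show ?thesis
    using cos_double_sin[of "x / 2"] by (simp add: power_divide)
qed

text \<open>Near 0 the quadratic bound on \<open>1 - cos x\<close> leaves
  \<open>x powr (1 - 2 * H)\<close>, integrable since \<open>H < 1\<close>. At infinity the bound 2
  leaves \<open>x powr (- 1 - 2 * H)\<close>, integrable since \<open>0 < H\<close>.\<close>

lemma integrable_one_minus_cos_spectral_weight: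
  assumes "0 < H" "H < 1"
  shows "integrable lborel (\<lambda>x. (1 - cos x) * spectral_weight H x)"
proof -
  have "(\<lambda>x. x powr (1 - 2 * H)) absolutely_integrable_on {0<..1}"
    using assms by (intro nonnegative_absolutely_integrable_1 integrable_on_powr_from_0') auto
  then have I1: "integrable lborel (\<lambda>x. indicator {0<..1} x * x powr (1 - 2 * H))"
    by (simp add: set_integrable_def integrable_completion)
  have "(\<lambda>x. x powr (- 1 - 2 * H)) integrable_on {1..}"
    using has_integral_powr_to_inf[of "- 1 - 2 * H" 1] assms by (auto simp: integrable_on_def)
  then have "(\<lambda>x. x powr (- 1 - 2 * H)) absolutely_integrable_on {1..}"
    by (rule nonnegative_absolutely_integrable_1) auto
  then have I2: "integrable lborel (\<lambda>x. indicator {1..} x * x powr (- 1 - 2 * H))"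
    by (simp add: set_integrable_def integrable_completion)
  show ?thesis
  proof (rule Bochner_Integration.integrable_bound)
    show "integrable lborel (\<lambda>x. indicator {0<..1} x * x powr (1 - 2 * H)
             + 2 * (indicator {1..} x * x powr (- 1 - 2 * H)))"
      using I1 I2 by auto
    show "AE x in lborel. norm ((1 - cos x) * spectral_weight H x)
      \<le> norm (indicator {0<..1} x * x powr (1 - 2 * H)
             + 2 * (indicator {1..} x * x powr (- 1 - 2 * H)))"
    proof (intro AE_I2)
      fix x :: real
      consider "x \<le> 0" | "0 < x" "x < 1" | "1 \<le> x" by linarith
      then show "norm ((1 - cos x) * spectral_weight H x)
        \<le> norm (indicator {0<..1} x * x powr (1 - 2 * H)
             + 2 * (indicator {1..} x * x powr (- 1 - 2 * H)))"
      proof cases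
        case 1
        then show ?thesis by (simp add: spectral_weight_def)
      next
        case 2
        have "(1 - cos x) * x powr (- 1 - 2 * H) \<le> x\<^sup>2 * x powr (- 1 - 2 * H)"
          using one_minus_cos_le[of x] zero_le_power2[of x] by (intro mult_right_mono) (linarith, simp)
        also have "\<dots> = x powr (1 - 2 * H)"
          using 2 by (simp flip: powr_numeral powr_add)
        finally show ?thesis
          using 2 by (simp add: spectral_weight_def)
      next
        case 3
        have "(1 - cos x) * x powr (- 1 - 2 * H) \<le> 2 * x powr (- 1 - 2 * H)"
          using cos_ge_minus_one[of x] by (intro mult_right_mono) (linarith, simp)
        then show ?thesis
          using 3 one_minus_cos_le[of 1] cos_ge_minus_one[of 1] by (simp add: spectral_weight_def indicator_def)
      qed
    qed
  qed measurable
qed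

text \<open>The scaling \<open>x \<mapsto> t x\<close> turns the integral into a multiple of \<open>t\<^sup>2\<^sup>H\<close>; the constant is
  never evaluated.\<close>
lemma spectral_representation:
  assumes "0 < H" "H < 1"
  shows "has_bochner_integral lborel (\<lambda>x. (1 - cos (t * x)) * spectral_weight H x)
    (\<bar>t\<bar> powr (2 * H) * (\<integral>x. (1 - cos x) * spectral_weight H x \<partial>lborel))"
proof -
  let ?g = "\<lambda>x. (1 - cos x) * spectral_weight H x"
  have pos: "has_bochner_integral lborel (\<lambda>x. (1 - cos (t * x)) * spectral_weight H x)
    (t powr (2 * H) * integral\<^sup>L lborel ?g)" if "0 < t" for t
  proof -
    \<comment> \<open>The weight is homogeneous of degree \<open>- 1 - 2 * H\<close>. The Jacobian
      \<open>t\<close> of the substitution then absorbs one power of \<open>t\<close>, which leaves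
      \<open>t powr (2 * H)\<close>.\<close>
    have eq: "(1 - cos (t * x)) * spectral_weight H x = t powr (1 + 2 * H) * ?g (0 + t * x)" for x
    proof (cases "0 < x")
      case True
      have "t powr (1 + 2 * H) * (t * x) powr (- 1 - 2 * H)
          = (t powr (1 + 2 * H) * t powr (- 1 - 2 * H)) * x powr (- 1 - 2 * H)"
        using that True by (simp add: powr_mult)
      also have "\<dots> = x powr (- 1 - 2 * H)"
        using that by (simp flip: powr_add)
      finally show ?thesis
        using True that by (simp add: spectral_weight_def)
    next
      case False
      then show ?thesis
        using that by (simp add: spectral_weight_def zero_less_mult_iff)
    qed
    have "integrable lborel (\<lambda>x. ?g (0 + t * x))"
      using integrable_one_minus_cos_spectral_weight[OF assms] that
      by (intro lborel_integrable_real_affine) auto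
    moreover have "integral\<^sup>L lborel ?g = t * (\<integral>x. ?g (0 + t * x) \<partial>lborel)"
      using lborel_integral_real_affine[of t ?g 0] that by simp
    moreover have "t powr (1 + 2 * H) = t powr (2 * H) * t"
      using that by (simp add: powr_add)
    ultimately show ?thesis
      unfolding eq has_bochner_integral_iff by simp
  qed
  consider "t = 0" | "0 < t" | "0 < - t" by linarith
  then show ?thesis
  proof cases
    case 1
    then show ?thesis by (simp add: has_bochner_integral_zero)
  next
    case 2
    then show ?thesis using pos[of t] by simp
  next
    case 3
    then show ?thesis using pos[of "- t"] by simp
  qed
qed

section \<open>Strict positive definiteness of the covariance\<close>

text \<open>The sum is a polynomial evaluated at \<open>cis (h * x)\<close>. A nonzero polynomial
  has finitely many roots, and on a short interval each root is hit by at most one \<open>x\<close>,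
  so the zeros there form a null set while the interval has positive length. The index 0 is excluded
  because its term vanishes for every coefficient.\<close>

lemma AE_trig_poly_zero_imp_coeff_zero:
  fixes c :: "nat \<Rightarrow> real"
  assumes "finite I" "0 \<notin> I" "0 < h"
    and ae: "AE x in lborel. 0 < x \<longrightarrow> (\<Sum>i\<in>I. of_real (c i) * (cis (h * real i * x) - 1)) = 0"
    and "i \<in> I"
  shows "c i = 0"
proof (rule ccontr)
  assume "c i \<noteq> 0"
  \<comment> \<open>The subtracted constant collects the terms \<open>- c i\<close>. It changes only
    the coefficient of degree 0, so \<open>0 \<notin> I\<close> keeps \<open>c i\<close> as the
    coefficient of degree \<open>i\<close>.\<close>
  define p where "p = (\<Sum>i\<in>I. monom (complex_of_real (c i)) i) - [:\<Sum>i\<in>I. complex_of_real (c i):]"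
  have poly_p: "poly p (cis (h * x)) = (\<Sum>i\<in>I. of_real (c i) * (cis (h * real i * x) - 1))" for x
    by (simp add: p_def poly_sum poly_monom Complex.DeMoivre algebra_simps sum_subtractf)
  have "coeff p i = of_real (c i)"
    using assms(1,2,5) by (cases i) (auto simp: p_def coeff_sum if_distrib sum.delta cong: if_cong)
  with \<open>c i \<noteq> 0\<close> have "p \<noteq> 0" by auto
  then have "finite {z. poly p z = 0}"
    by (rule poly_roots_finite)
  \<comment> \<open>For \<open>x\<close> below \<open>1 / h\<close> the angle \<open>h * x\<close>
    lies in (0, 1), inside the interval from 0 to pi on which cosine is injective.\<close>
  moreover have "inj_on (\<lambda>x. cis (h * x)) {0<..<1 / h}"
  proof (rule inj_onI)
    fix x y assume xy: "x \<in> {0<..<1 / h}" "y \<in> {0<..<1 / h}" "cis (h * x) = cis (h * y)"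
    have "h * x < 1" "h * y < 1" "0 < h * x" "0 < h * y"
      using xy \<open>0 < h\<close> by (auto simp: field_simps)
    moreover have "cos (h * x) = cos (h * y)"
      using xy(3) by (simp add: complex_eq_iff)
    ultimately have "h * x = h * y"
      using pi_gt3 by (intro cos_inj_pi[of "h * x" "h * y"]; linarith)
    with \<open>0 < h\<close> show "x = y" by simp
  qed
  ultimately have fin: "finite {x \<in> {0<..<1 / h}. poly p (cis (h * x)) = 0}"
    using finite_vimage_IntI[of "{z. poly p z = 0}" "\<lambda>x. cis (h * x)" "{0<..<1 / h}"]
    by (simp add: vimage_def Int_def conj_commute)
  have "AE x in lborel. x \<notin> {x \<in> {0<..<1 / h}. poly p (cis (h * x)) = 0}"
    by (intro AE_not_in finite_imp_null_set_lborel fin)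
  with ae have "AE x in lborel. x \<notin> {0<..<1 / h}"
    by eventually_elim (auto simp: poly_p)
  then have "emeasure lborel {0<..<1 / h} = 0"
    by (subst (asm) AE_iff_measurable[of "{0<..<1 / h}"]) auto
  with \<open>0 < h\<close> show False by simp
qed

text \<open>The quadratic form equals, up to a constant,
  \<open>\<integral> \<bar>\<Sum> c\<^sub>i (e\<^sup>i\<^sup>t\<^sup>x - 1)\<bar>\<^sup>2 x\<^bsup>-1-2H\<^esup> dx\<close> over the positive half-line, with \<open>t = h i\<close>.\<close>
lemma fbm_kernel_nondegenerate:
  fixes c :: "nat \<Rightarrow> real"
  assumes H: "0 < H" "H < 1" and I: "finite I" "0 \<notin> I" and h: "0 < h"
    and zero: "(\<Sum>i\<in>I. \<Sum>j\<in>I. c i * c j * fbm_kernel H (h * real i) (h * real j)) = 0"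
    and "i \<in> I"
  shows "c i = 0"
proof -
  define K where "K = (\<integral>x. (1 - cos x) * spectral_weight H x \<partial>lborel)"
  define P where "P x = (\<Sum>i\<in>I. complex_of_real (c i) * (cis (h * real i * x) - 1))" for x
  define e where "e t x = (1 - cos (t * x)) * spectral_weight H x" for t x
  have e: "has_bochner_integral lborel (e t) (\<bar>t\<bar> powr (2 * H) * K)" for t
    unfolding e_def K_def by (rule spectral_representation[OF H])
  \<comment> \<open>With angles p and q, the real and imaginary parts contribute (cos p - 1)(cos q -
    1) + sin p sin q = (1 - cos p) + (1 - cos q) - (1 - cos (p - q)). These are the three terms of
    the covariance in spectral form.\<close>
  have P_sq: "(cmod (P x))\<^sup>2 * spectral_weight H x = (\<Sum>i\<in>I. \<Sum>j\<in>I. c i * c j *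
      (e (h * real i) x + e (h * real j) x - e (h * real i - h * real j) x))" for x
  proof -
    have "(cmod (P x))\<^sup>2 = (\<Sum>i\<in>I. c i * (cos (h * real i * x) - 1))\<^sup>2
        + (\<Sum>i\<in>I. c i * sin (h * real i * x))\<^sup>2"
      by (simp add: cmod_power2 P_def)
    also have "\<dots> = (\<Sum>i\<in>I. \<Sum>j\<in>I. c i * c j * ((1 - cos (h * real i * x)) +
        (1 - cos (h * real j * x)) - (1 - cos ((h * real i - h * real j) * x))))"
      unfolding power2_eq_square sum_product sum.distrib[symmetric]
      by (intro sum.cong refl) (simp add: left_diff_distrib cos_diff algebra_simps)
    finally show ?thesis
      by (simp only: e_def sum_distrib_right) (simp add: algebra_simps)
  qed
  have "has_bochner_integral lborel (\<lambda>x. (cmod (P x))\<^sup>2 * spectral_weight H x)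
      (\<Sum>i\<in>I. \<Sum>j\<in>I. c i * c j * (\<bar>h * real i\<bar> powr (2 * H) * K + \<bar>h * real j\<bar> powr (2 * H) * K
         - \<bar>h * real i - h * real j\<bar> powr (2 * H) * K))"
    unfolding P_sq
    by (intro has_bochner_integral_sum has_bochner_integral_mult_right has_bochner_integral_add
        has_bochner_integral_diff e)
  also have "(\<Sum>i\<in>I. \<Sum>j\<in>I. c i * c j * (\<bar>h * real i\<bar> powr (2 * H) * K + \<bar>h * real j\<bar> powr (2 * H) * K
         - \<bar>h * real i - h * real j\<bar> powr (2 * H) * K))
      = 2 * K * (\<Sum>i\<in>I. \<Sum>j\<in>I. c i * c j * fbm_kernel H (h * real i) (h * real j))"
    unfolding sum_distrib_left
    using h by (intro sum.cong refl) (simp add: fbm_kernel_def algebra_simps)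
  finally have int: "has_bochner_integral lborel (\<lambda>x. (cmod (P x))\<^sup>2 * spectral_weight H x) 0"
    by (simp add: zero)
  have "AE x in lborel. (cmod (P x))\<^sup>2 * spectral_weight H x = 0"
    using int by (subst integral_nonneg_eq_0_iff_AE[symmetric])
      (auto simp: has_bochner_integral_iff spectral_weight_nonneg)
  then have "AE x in lborel. 0 < x \<longrightarrow> P x = 0"
    by eventually_elim (use spectral_weight_pos[of _ H] in fastforce)
  then show ?thesis
    unfolding P_def by (rule AE_trig_poly_zero_imp_coeff_zero[OF I h _ \<open>i \<in> I\<close>])
qed

section \<open>Inverse of a matrix with trivial kernel\<close>

text \<open>A trivial kernel forces a nonzero determinant, so \<open>mat_inverse\<close> returns
  \<open>Some\<close> and \<open>the\<close> yields a genuine inverse instead of an unspecified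
  value.\<close>

lemma mat_inverse_right_inverse:
  fixes A :: "real mat"
  assumes A: "A \<in> carrier_mat n n"
    and inj: "\<And>v i. (\<And>k. k < n \<Longrightarrow> (\<Sum>j<n. A $$ (k, j) * v j) = 0) \<Longrightarrow> i < n \<Longrightarrow> v i = 0"
    and ij: "i < n" "j < n"
  shows "(\<Sum>k<n. A $$ (i, k) * the (mat_inverse A) $$ (k, j)) = (if i = j then 1 else 0)"
proof -
  have "Determinant.det A \<noteq> 0"
  proof
    assume "Determinant.det A = 0"
    then obtain v where v: "v \<in> carrier_vec n" "v \<noteq> 0\<^sub>v n" "A *\<^sub>v v = 0\<^sub>v n"
      using det_0_iff_vec_prod_zero_field[OF A] by blast
    have "(\<Sum>j<n. A $$ (k, j) * vec_index v j) = 0" if "k < n" for k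
    proof -
      have "vec_index (A *\<^sub>v v) k = (\<Sum>j<n. A $$ (k, j) * vec_index v j)"
        using A v(1) that by (simp add: scalar_prod_def lessThan_atLeast0)
      then show ?thesis using v(3) that by simp
    qed
    then have "vec_index v i = 0" if "i < n" for i
      using inj[of "vec_index v" i] that by blast
    then have "v = 0\<^sub>v n" using v(1) by (intro eq_vecI) auto
    with v(2) show False by simp
  qed
  then have "A \<in> Units (ring_mat TYPE(real) n ())"
    by (rule det_non_zero_imp_unit[OF A])
  then obtain S where S: "mat_inverse A = Some S"
    using mat_inverse(1)[OF A, where b = "()"] by (cases "mat_inverse A") auto
  from mat_inverse(2)[OF A S] have AS: "A * S = 1\<^sub>m n" "S \<in> carrier_mat n n" by auto
  have "(A * S) $$ (i, j) = (\<Sum>k<n. A $$ (i, k) * S $$ (k, j))"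
    using A AS(2) ij by (simp add: scalar_prod_def lessThan_atLeast0)
  then show ?thesis using AS(1) ij S by simp
qed

section \<open>Gaussian moments and almost sure convergence\<close>

text \<open>The factor is the double factorial (2k-1)!!. Expressing the moment through the variance
  also covers degenerate laws, where both sides are \<open>0 ^ k\<close>.\<close>

lemma gaussian_rv_even_moment:
  assumes "prob_space M" "gaussian_rv M X" and mean: "(\<integral>\<omega>. X \<omega> \<partial>M) = 0"
  shows "integrable M (\<lambda>\<omega>. X \<omega> ^ (2 * k))"
    and "(\<integral>\<omega>. X \<omega> ^ (2 * k) \<partial>M) = fact (2 * k) / (2 ^ k * fact k) * (\<integral>\<omega>. (X \<omega>)\<^sup>2 \<partial>M) ^ k"
proof -
  interpret prob_space M by fact
  have [measurable]: "X \<in> borel_measurable M"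
    using assms(2) by (simp add: gaussian_rv_def)
  have "integrable M (\<lambda>\<omega>. X \<omega> ^ (2 * k)) \<and>
    (\<integral>\<omega>. X \<omega> ^ (2 * k) \<partial>M) = fact (2 * k) / (2 ^ k * fact k) * (\<integral>\<omega>. (X \<omega>)\<^sup>2 \<partial>M) ^ k"
  proof -
    from assms(2) consider
      (normal) \<mu> \<sigma> where "\<sigma> > 0" "distributed M lborel X (normal_density \<mu> \<sigma>)"
      | (const) \<mu> where "AE \<omega> in M. X \<omega> = \<mu>"
      by (auto simp: gaussian_rv_def)
    then show ?thesis
    proof cases
      case normal
      have "\<mu> = 0"
        using normal_distributed_expectation[OF normal] mean by simp
      with normal have D: "distributed M lborel X (normal_density 0 \<sigma>)" by simp
      have mom: "has_bochner_integral M (\<lambda>\<omega>. X \<omega> ^ (2 * k))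
          (fact (2 * k) / ((2 / \<sigma>\<^sup>2) ^ k * fact k))" for k
      proof -
        note nm = normal_moment_even[OF normal(1), of 0 k, unfolded has_bochner_integral_iff diff_0_right]
        have "integrable M (\<lambda>\<omega>. X \<omega> ^ (2 * k))"
          by (rule distributed_integrable[OF D, THEN iffD1, OF _ _ conjunct1[OF nm]]) simp_all
        moreover have "(\<integral>\<omega>. X \<omega> ^ (2 * k) \<partial>M) = (\<integral>x. normal_density 0 \<sigma> x * x ^ (2 * k) \<partial>lborel)"
          by (rule distributed_integral[OF D, symmetric]) simp_all
        ultimately show ?thesis
          using conjunct2[OF nm] unfolding has_bochner_integral_iff by metis
      qed
      \<comment> \<open>The moment formula at order 2 identifies the parameter with the
        variance.\<close>
      have "(\<integral>\<omega>. (X \<omega>)\<^sup>2 \<partial>M) = \<sigma>\<^sup>2"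
        using mom[of 1] by (simp add: has_bochner_integral_iff)
      then show ?thesis
        using mom[of k] by (simp add: has_bochner_integral_iff power_divide)
    next
      case const
      have "(\<integral>\<omega>. X \<omega> \<partial>M) = (\<integral>\<omega>. \<mu> \<partial>M)"
        using const by (intro integral_cong_AE) auto
      with mean have "\<mu> = 0" by (simp add: prob_space)
      with const have 0: "AE \<omega> in M. X \<omega> ^ (2 * k) = 0 ^ (2 * k)" for k by auto
      have int: "integrable M (\<lambda>\<omega>. X \<omega> ^ (2 * k))" for k
        using integrable_cong_AE[THEN iffD2, OF _ _ 0[of k]] by simp
      have mom: "(\<integral>\<omega>. X \<omega> ^ (2 * k) \<partial>M) = 0 ^ (2 * k)" for k
        using integral_cong_AE[OF _ _ 0[of k]] by (simp add: prob_space)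
      show ?thesis
        using int[of k] mom[of k] mom[of 1] by (cases k) auto
    qed
  qed
  then show "integrable M (\<lambda>\<omega>. X \<omega> ^ (2 * k))"
    and "(\<integral>\<omega>. X \<omega> ^ (2 * k) \<partial>M) = fact (2 * k) / (2 ^ k * fact k) * (\<integral>\<omega>. (X \<omega>)\<^sup>2 \<partial>M) ^ k"
    by auto
qed

text \<open>\<open>gaussian_process\<close> speaks of sums over sets of times. Injectivity of
  \<open>\<tau>\<close> turns a sum over indices into such a sum.\<close>

lemma gaussian_process_linear_combination:
  assumes "gaussian_process M T X" "finite I" "inj_on \<tau> I" "\<tau> ` I \<subseteq> T"
  shows "gaussian_rv M (\<lambda>\<omega>. \<Sum>i\<in>I. w i * X (\<tau> i) \<omega>)"
proof -
  have "gaussian_rv M (\<lambda>\<omega>. \<Sum>t\<in>\<tau> ` I. w (the_inv_into I \<tau> t) * X t \<omega>)"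
    using assms by (simp add: gaussian_process_def)
  then show ?thesis
    using assms(3) by (simp add: sum.reindex the_inv_into_f_f)
qed

text \<open>By monotone convergence the series of the nonnegative variables
  \<open>X n \<omega> ^ (2 * k)\<close> has finite expectation. It therefore converges almost
  surely, and its terms tend to zero.\<close>

lemma AE_tendsto_zero_if_summable_even_moments:
  fixes X :: "nat \<Rightarrow> 'a \<Rightarrow> real"
  assumes int: "\<And>n. integrable M (\<lambda>\<omega>. X n \<omega> ^ (2 * k))"
    and le: "\<And>n. (\<integral>\<omega>. X n \<omega> ^ (2 * k) \<partial>M) \<le> b n"
    and "summable b" "0 < k"
  shows "AE \<omega> in M. (\<lambda>n. X n \<omega>) \<longlonglongrightarrow> 0"
proof -
  have b: "0 \<le> b n" for n
    by (rule order_trans[OF integral_nonneg_AE le]) (auto simp: power_mult)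
  have [measurable]: "(\<lambda>\<omega>. X n \<omega> ^ (2 * k)) \<in> borel_measurable M" for n
    using int by (rule borel_measurable_integrable)
  have "(\<integral>\<^sup>+\<omega>. (\<Sum>n. ennreal (X n \<omega> ^ (2 * k))) \<partial>M) = (\<Sum>n. \<integral>\<^sup>+\<omega>. ennreal (X n \<omega> ^ (2 * k)) \<partial>M)"
    by (rule nn_integral_suminf) measurable
  also have "\<dots> \<le> (\<Sum>n. ennreal (b n))"
    using le int by (intro suminf_le) (auto simp: nn_integral_eq_integral power_mult ennreal_leI)
  also have "\<dots> = ennreal (\<Sum>n. b n)"
    using b \<open>summable b\<close> by (rule suminf_ennreal2)
  finally have "(\<integral>\<^sup>+\<omega>. (\<Sum>n. ennreal (X n \<omega> ^ (2 * k))) \<partial>M) \<noteq> \<infinity>"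
    by (auto simp: top_unique)
  then have "AE \<omega> in M. (\<Sum>n. ennreal (X n \<omega> ^ (2 * k))) \<noteq> \<infinity>"
    by (intro nn_integral_PInf_AE) measurable
  then show ?thesis
  proof eventually_elim
    case (elim \<omega>)
    then have "summable (\<lambda>n. X n \<omega> ^ (2 * k))"
      by (intro summable_suminf_not_top) (auto simp: power_mult)
    then have "(\<lambda>n. \<bar>X n \<omega>\<bar> ^ (2 * k)) \<longlonglongrightarrow> 0"
      by (simp add: summable_LIMSEQ_zero power_even_abs)
    then have "(\<lambda>n. root (2 * k) (\<bar>X n \<omega>\<bar> ^ (2 * k))) \<longlonglongrightarrow> root (2 * k) 0"
      by (rule tendsto_real_root)
    then show ?case
      using \<open>0 < k\<close> by (simp add: real_root_power_cancel tendsto_rabs_zero_iff)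
  qed
qed

section \<open>Covariance matrix and linear combinations of the observations\<close>

lemma fbm_covariance:
  assumes "fractional_brownian_motion M H B" "0 \<le> t" "0 \<le> s"
  shows "covariance M (B t) (B s) = fbm_kernel H t s"
  using assms by (simp add: covariance_def fractional_brownian_motion_def fbm_kernel_def)

lemma cov_inverse_right_inverse:
  assumes "0 < H" "H < 1" "fractional_brownian_motion M H B" "0 < N"
    and ij: "i \<in> {1..num_obs \<alpha> N}" "j \<in> {1..num_obs \<alpha> N}"
  shows "(\<Sum>k=1..num_obs \<alpha> N. fbm_kernel H (real i / real N) (real k / real N) * cov_inverse M B \<alpha> N k j)
    = (if i = j then 1 else 0)"
proof -
  define n where "n = num_obs \<alpha> N"
  define \<Gamma> where "\<Gamma> = cov_matrix M B \<alpha> N"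
  have \<Gamma>: "\<Gamma> \<in> carrier_mat n n"
    by (simp add: \<Gamma>_def cov_matrix_def n_def)
  have \<Gamma>_nth: "\<Gamma> $$ (k, l) = fbm_kernel H (real (Suc k) / real N) (real (Suc l) / real N)"
    if "k < n" "l < n" for k l
    using that fbm_covariance[OF assms(3)] by (simp add: \<Gamma>_def cov_matrix_def n_def)
  obtain i' j' where ij': "i = Suc i'" "j = Suc j'" "i' < n" "j' < n"
    using ij by (cases i; cases j) (auto simp: n_def)
  have "(\<Sum>k<n. \<Gamma> $$ (i', k) * the (mat_inverse \<Gamma>) $$ (k, j')) = (if i' = j' then 1 else 0)"
  proof (rule mat_inverse_right_inverse[OF \<Gamma>])
    fix v :: "nat \<Rightarrow> real" and i
    assume v: "\<And>k. k < n \<Longrightarrow> (\<Sum>j<n. \<Gamma> $$ (k, j) * v j) = 0" and "i < n"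
    \<comment> \<open>Shifts the 0-based matrix index to the 1-based time index. The quadratic form
      of \<open>c\<close> at step \<open>1 / real N\<close> is then the product of \<open>v\<close>
      with \<open>\<Gamma>\<close> applied to \<open>v\<close>, which is zero on the kernel.\<close>
    define c where "c k = v (k - 1)" for k
    have "(\<Sum>k\<in>{1..n}. \<Sum>l\<in>{1..n}. c k * c l *
        fbm_kernel H (1 / real N * real k) (1 / real N * real l))
      = (\<Sum>k<n. v k * (\<Sum>l<n. \<Gamma> $$ (k, l) * v l))"
      by (simp add: sum.atLeast1_atMost_eq c_def \<Gamma>_nth sum_distrib_left ac_simps)
    also have "\<dots> = 0" by (simp add: v)
    finally have "c (Suc i) = 0"
      using \<open>i < n\<close> \<open>0 < N\<close>
      by (intro fbm_kernel_nondegenerate[OF assms(1,2), of "{1..n}" "1 / real N" c "Suc i"]) auto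
    then show "v i = 0" by (simp add: c_def)
  qed (use ij' in auto)
  then show ?thesis
    using ij' by (simp add: sum.atLeast1_atMost_eq cov_inverse_def \<Gamma>_nth flip: n_def \<Gamma>_def)
qed

lemma fbm_kernel_commute: "fbm_kernel H t s = fbm_kernel H s t"
  by (simp add: fbm_kernel_def abs_minus_commute)

lemma fbm_kernel_self: "fbm_kernel H t t = t powr (2 * H)"
  by (simp add: fbm_kernel_def)

lemma fbm_gaussian_rv:
  assumes "fractional_brownian_motion M H B" "0 \<le> t"
  shows "gaussian_rv M (B t)"
  using gaussian_process_linear_combination[of M "{0..}" B "{t}" "\<lambda>t. t" "\<lambda>_. 1"] assms
  by (simp add: fractional_brownian_motion_def)

text \<open>The definition of the process fixes only the value of this integral, and the Bochner
  integral also has a value, zero, for non-integrable functions. Integrability comes from the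
  Gaussian second moments, which dominate the product.\<close>

lemma fbm_product_integral:
  assumes fbm: "fractional_brownian_motion M H B" and "0 \<le> t" "0 \<le> s"
  shows "has_bochner_integral M (\<lambda>\<omega>. B t \<omega> * B s \<omega>) (fbm_kernel H t s)"
proof -
  have ps: "prob_space M"
    using fbm by (simp add: fractional_brownian_motion_def gaussian_process_def)
  have [measurable]: "B u \<in> borel_measurable M" if "0 \<le> u" for u
    using fbm_gaussian_rv[OF fbm that] by (simp add: gaussian_rv_def)
  have sq: "integrable M (\<lambda>\<omega>. (B u \<omega>)\<^sup>2)" if "0 \<le> u" for u
    using gaussian_rv_even_moment(1)[OF ps fbm_gaussian_rv[OF fbm that], of 1] fbm that
    by (simp add: fractional_brownian_motion_def)
  have "integrable M (\<lambda>\<omega>. B t \<omega> * B s \<omega>)"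
  proof (rule Bochner_Integration.integrable_bound)
    show "integrable M (\<lambda>\<omega>. (B t \<omega>)\<^sup>2 + (B s \<omega>)\<^sup>2)"
      using sq assms by simp
    show "AE \<omega> in M. norm (B t \<omega> * B s \<omega>) \<le> norm ((B t \<omega>)\<^sup>2 + (B s \<omega>)\<^sup>2)"
    proof (rule AE_I2)
      fix \<omega>
      show "norm (B t \<omega> * B s \<omega>) \<le> norm ((B t \<omega>)\<^sup>2 + (B s \<omega>)\<^sup>2)"
        using sum_squares_bound[of "B t \<omega>" "B s \<omega>"] sum_squares_bound[of "- B t \<omega>" "B s \<omega>"]
          sum_power2_ge_zero[of "B t \<omega>" "B s \<omega>"]
        unfolding real_norm_def by (simp only: power2_minus)
    qed
  qed (use assms in measurable)
  then show ?thesis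
    using assms by (simp add: has_bochner_integral_iff fractional_brownian_motion_def fbm_kernel_def)
qed

lemma fbm_linear_combination_second_moment:
  assumes "fractional_brownian_motion M H B" "\<And>i. i \<in> I \<Longrightarrow> 0 \<le> \<tau> i"
  shows "has_bochner_integral M (\<lambda>\<omega>. (\<Sum>i\<in>I. c i * B (\<tau> i) \<omega>)\<^sup>2)
    (\<Sum>i\<in>I. \<Sum>j\<in>I. c i * c j * fbm_kernel H (\<tau> i) (\<tau> j))"
proof -
  have "(\<Sum>i\<in>I. c i * B (\<tau> i) \<omega>)\<^sup>2 = (\<Sum>i\<in>I. \<Sum>j\<in>I. c i * c j * (B (\<tau> i) \<omega> * B (\<tau> j) \<omega>))" for \<omega>
    by (simp add: power2_eq_square sum_product ac_simps)
  then show ?thesis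
    using assms by (auto intro!: has_bochner_integral_sum has_bochner_integral_mult_right fbm_product_integral)
qed

lemma fbm_linear_combination_mean:
  assumes fbm: "fractional_brownian_motion M H B" and "\<And>i. i \<in> I \<Longrightarrow> 0 \<le> \<tau> i"
  shows "(\<integral>\<omega>. (\<Sum>i\<in>I. c i * B (\<tau> i) \<omega>) \<partial>M) = 0"
proof -
  interpret prob_space M
    using fbm by (simp add: fractional_brownian_motion_def gaussian_process_def)
  have "integrable M (B t)" if "0 \<le> t" for t
  proof (rule square_integrable_imp_integrable)
    show "B t \<in> borel_measurable M"
      using fbm_gaussian_rv[OF fbm that] by (simp add: gaussian_rv_def)
    show "integrable M (\<lambda>\<omega>. (B t \<omega>)\<^sup>2)"
      using fbm_product_integral[OF fbm that that]
      by (simp add: has_bochner_integral_iff power2_eq_square)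
  qed
  then show ?thesis
    using assms by (simp add: Bochner_Integration.integral_sum fractional_brownian_motion_def)
qed

section \<open>Error of the estimator and its variance\<close>

text \<open>Here \<open>w = \<Gamma>\<^sup>-\<^sup>1 u\<close>, \<open>Z = \<Sum> w\<^sub>i B\<^bsub>i/N\<^esub>\<close> and \<open>D = u\<^sup>T \<Gamma>\<^sup>-\<^sup>1 u = Var Z\<close>. The lower bound on \<open>D\<close>
  follows from \<open>Var (s Z - B\<^bsub>n/N\<^esub>) \<ge> 0\<close> for all \<open>s\<close>, as \<open>Z\<close> and \<open>B\<^bsub>n/N\<^esub>\<close> have covariance \<open>n\<close>.\<close>
lemma drift_mle_error:
  assumes H: "0 < H" "H < 1" and fbm: "fractional_brownian_motion M H B"
    and N: "0 < N" and n_def: "n = num_obs \<alpha> N" and n: "0 < n"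
  obtains w D where
    "0 < D" "(real n)\<^sup>2 \<le> D * (real n / real N) powr (2 * H)"
    "(\<integral>\<omega>. (\<Sum>i=1..n. w i * B (real i / real N) \<omega>)\<^sup>2 \<partial>M) = D"
    "\<And>\<omega>. drift_mle M B a \<alpha> N \<omega> - a = real N / D * (\<Sum>i=1..n. w i * B (real i / real N) \<omega>)"
proof -
  define R where "R i j = fbm_kernel H (real i / real N) (real j / real N)" for i j
  define w where "w i = (\<Sum>j=1..n. real j * cov_inverse M B \<alpha> N i j)" for i
  define D where "D = (\<Sum>i=1..n. real i * w i)"
  define Z where "Z \<omega> = (\<Sum>i=1..n. w i * B (real i / real N) \<omega>)" for \<omega>
  have R_commute: "R i j = R j i" for i j
    by (simp add: R_def fbm_kernel_commute)
  \<comment> \<open>The equation \<open>\<Gamma>\<close> w = u, obtained by exchanging the sums and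
    using the right inverse.\<close>
  have Rw: "(\<Sum>j=1..n. R i j * w j) = real i" if "i \<in> {1..n}" for i
  proof -
    have "(\<Sum>j=1..n. R i j * w j) = (\<Sum>j=1..n. \<Sum>k=1..n. real k * (R i j * cov_inverse M B \<alpha> N j k))"
      by (simp add: w_def sum_distrib_left ac_simps)
    also have "\<dots> = (\<Sum>k=1..n. real k * (\<Sum>j=1..n. R i j * cov_inverse M B \<alpha> N j k))"
      by (subst sum.swap) (simp add: sum_distrib_left)
    also have "\<dots> = (\<Sum>k=1..n. real k * (if i = k then 1 else 0))"
      using cov_inverse_right_inverse[OF H fbm N] that
      by (intro sum.cong refl) (simp add: R_def n_def)
    finally show ?thesis using that by (simp add: if_distrib cong: if_cong)
  qed
  have second: "has_bochner_integral M (\<lambda>\<omega>. (\<Sum>i=1..n. c i * B (real i / real N) \<omega>)\<^sup>2)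
      (\<Sum>i=1..n. c i * (\<Sum>j=1..n. R i j * c j))" for c
    using fbm_linear_combination_second_moment[OF fbm, of "{1..n}" "\<lambda>i. real i / real N" c]
    by (simp add: R_def sum_distrib_left ac_simps)
  have "(\<Sum>i=1..n. w i * (\<Sum>j=1..n. R i j * w j)) = D"
    unfolding D_def by (intro sum.cong refl) (simp only: Rw mult.commute[of "w _"])
  with second[of w] have var: "(\<integral>\<omega>. (Z \<omega>)\<^sup>2 \<partial>M) = D"
    by (simp add: has_bochner_integral_iff Z_def)
  have quad: "0 \<le> s\<^sup>2 * D - 2 * s * real n + R n n" for s
  proof -
    \<comment> \<open>Coordinate vector of the last observation: the coefficients
      \<open>s * w i - e i\<close> belong to s Z minus the process at time n/N.\<close>
    define e where "e i = (if i = n then 1 else 0 :: real)" for i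
    have e: "(\<Sum>i=1..n. f i * e i) = f n" for f :: "nat \<Rightarrow> real"
      using n by (simp add: e_def if_distrib cong: if_cong)
    have "0 \<le> (\<Sum>i=1..n. (s * w i - e i) * (\<Sum>j=1..n. R i j * (s * w j - e j)))"
      unfolding has_bochner_integral_integral_eq[OF second[of "\<lambda>i. s * w i - e i"], symmetric]
      by (intro integral_nonneg_AE) auto
    also have "\<dots> = (\<Sum>i=1..n. (s * w i - e i) * (s * real i - R i n))"
    proof (intro sum.cong refl)
      fix i assume i: "i \<in> {1..n}"
      have "(\<Sum>j=1..n. R i j * (s * w j - e j)) = s * (\<Sum>j=1..n. R i j * w j) - (\<Sum>j=1..n. R i j * e j)"
        by (simp add: right_diff_distrib sum_subtractf sum_distrib_left ac_simps)
      also have "\<dots> = s * real i - R i n"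
        unfolding Rw[OF i] e ..
      finally show "(s * w i - e i) * (\<Sum>j=1..n. R i j * (s * w j - e j))
          = (s * w i - e i) * (s * real i - R i n)" by simp
    qed
    also have "\<dots> = s\<^sup>2 * D - s * (\<Sum>i=1..n. R n i * w i) - (\<Sum>i=1..n. (s * real i - R i n) * e i)"
      unfolding D_def sum_distrib_left sum_subtractf[symmetric]
      by (intro sum.cong refl) (simp add: R_commute[of n] power2_eq_square algebra_simps)
    also have "\<dots> = s\<^sup>2 * D - 2 * s * real n + R n n"
      unfolding e using n by (subst Rw) simp_all
    finally show ?thesis .
  qed
  have "0 \<le> D"
    unfolding var[symmetric] by (intro integral_nonneg_AE) auto
  moreover have "D \<noteq> 0"
    \<comment> \<open>If \<open>D\<close> were 0, this choice of \<open>s\<close> would give the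
      quadratic the value -1.\<close>
    using quad[of "(R n n + 1) / (2 * real n)"] n by auto
  ultimately have D: "0 < D" by simp
  have "(real n)\<^sup>2 \<le> D * R n n"
    \<comment> \<open>The minimizer of the quadratic in \<open>s\<close>.\<close>
    using quad[of "real n / D"] D by (simp add: power2_eq_square field_simps)
  then have bound: "(real n)\<^sup>2 \<le> D * (real n / real N) powr (2 * H)"
    by (simp add: R_def fbm_kernel_self)
  have "drift_mle M B a \<alpha> N \<omega> - a = real N / D * Z \<omega>" for \<omega>
  proof -
    have "(\<Sum>i=1..n. \<Sum>j=1..n. real j * cov_inverse M B \<alpha> N i j * observation B a N i \<omega>)
        = (\<Sum>i=1..n. w i * observation B a N i \<omega>)"
      by (simp add: w_def sum_distrib_right)
    \<comment> \<open>The drift enters through the sum of \<open>real i * w i\<close>, which is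
      \<open>D\<close>. Dividing by \<open>D\<close> and multiplying by \<open>N\<close> thus
      recovers exactly \<open>a\<close>, and only the noise \<open>Z\<close> remains.\<close>
    also have "\<dots> = a / real N * D + Z \<omega>"
      by (simp add: observation_def D_def Z_def sum_distrib_left sum.distrib algebra_simps)
    finally have num: "(\<Sum>i=1..n. \<Sum>j=1..n. real j * cov_inverse M B \<alpha> N i j * observation B a N i \<omega>)
        = a / real N * D + Z \<omega>" .
    have den: "(\<Sum>i=1..n. \<Sum>j=1..n. real i * real j * cov_inverse M B \<alpha> N i j) = D"
      by (simp add: D_def w_def sum_distrib_left ac_simps)
    show ?thesis
      using D N num den by (simp add: drift_mle_def flip: n_def) (simp add: field_simps)
  qed
  with that[OF D bound] var show thesis by (simp add: Z_def)
qed

text \<open>For a real y \<ge> 1 the floor is at least 1 and exceeds y - 1, so twice the floor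
  exceeds y.\<close>

lemma num_obs_ge:
  assumes "0 < \<alpha>" "0 < N"
  shows "real N powr \<alpha> / 2 \<le> real (num_obs \<alpha> N)" "0 < num_obs \<alpha> N"
proof -
  have "1 \<le> real N powr \<alpha>"
    using assms by (intro ge_one_powr_ge_zero) auto
  then have "1 \<le> \<lfloor>real N powr \<alpha>\<rfloor>" "real (num_obs \<alpha> N) = real_of_int \<lfloor>real N powr \<alpha>\<rfloor>"
    by (auto simp: num_obs_def)
  then show "real N powr \<alpha> / 2 \<le> real (num_obs \<alpha> N)" "0 < num_obs \<alpha> N"
    by linarith+
qed

text \<open>The error is a centered Gaussian of variance \<open>(real N)\<^sup>2 / D\<close>, so all
  even moments follow from a bound on this variance. The lower bound on \<open>D\<close> provides
  it.\<close>

lemma drift_mle_error_moment: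
  assumes H: "0 < H" "H < 1" and fbm: "fractional_brownian_motion M H B" and "1 < \<alpha>" "0 < N"
  shows "integrable M (\<lambda>\<omega>. (drift_mle M B a \<alpha> N \<omega> - a) ^ (2 * k))"
    and "(\<integral>\<omega>. (drift_mle M B a \<alpha> N \<omega> - a) ^ (2 * k) \<partial>M) \<le> fact (2 * k) / (2 ^ k * fact k) *
      (2 powr (2 - 2 * H) * real N powr (- ((\<alpha> - 1) * (2 - 2 * H)))) ^ k"
proof -
  define n where "n = num_obs \<alpha> N"
  have n: "0 < n" "real N powr \<alpha> / 2 \<le> real n"
    using num_obs_ge[of \<alpha> N] assms by (auto simp: n_def)
  obtain w D where D: "0 < D" "(real n)\<^sup>2 \<le> D * (real n / real N) powr (2 * H)"
    and var: "(\<integral>\<omega>. (\<Sum>i=1..n. w i * B (real i / real N) \<omega>)\<^sup>2 \<partial>M) = D"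
    and err: "\<And>\<omega>. drift_mle M B a \<alpha> N \<omega> - a
      = real N / D * (\<Sum>i=1..n. w i * B (real i / real N) \<omega>)"
    using drift_mle_error[OF H fbm \<open>0 < N\<close> n_def n(1)] by blast
  define X where "X \<omega> = (\<Sum>i=1..n. w i * B (real i / real N) \<omega>)" for \<omega>
  have err_X: "drift_mle M B a \<alpha> N \<omega> - a = real N / D * X \<omega>" for \<omega>
    by (simp add: err X_def)
  have var_X: "(\<integral>\<omega>. (X \<omega>)\<^sup>2 \<partial>M) = D"
    using var by (simp add: X_def)
  have gp: "prob_space M" "gaussian_process M {0..} B"
    using fbm by (auto simp: fractional_brownian_motion_def gaussian_process_def)
  have X: "gaussian_rv M X"
    unfolding X_def using \<open>0 < N\<close>
    by (intro gaussian_process_linear_combination[OF gp(2)]) (auto simp: inj_on_def)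
  have X0: "(\<integral>\<omega>. X \<omega> \<partial>M) = 0"
    unfolding X_def by (intro fbm_linear_combination_mean[OF fbm]) auto
  note moment = gaussian_rv_even_moment[OF gp(1) X X0, of k]
  show "integrable M (\<lambda>\<omega>. (drift_mle M B a \<alpha> N \<omega> - a) ^ (2 * k))"
    unfolding err_X power_mult_distrib using moment(1) by simp
  have "(real N)\<^sup>2 / D \<le> (real N)\<^sup>2 * (real n / real N) powr (2 * H) / (real n)\<^sup>2"
    using mult_left_mono[OF D(2), of "(real N)\<^sup>2"] D(1) n(1) by (simp add: field_simps)
  also have "\<dots> = (real n / real N) powr (2 * H) / (real n / real N) powr 2"
    using n \<open>0 < N\<close> by (simp add: power_divide)
  also have "\<dots> = (real n / real N) powr (2 * H - 2)"
    by (simp add: powr_diff)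
  \<comment> \<open>The exponent \<open>2 * H - 2\<close> is negative, so the lower bound on n/N
    becomes an upper bound. The 2 under the fraction comes from rounding the number of observations
    down.\<close>
  also have "\<dots> \<le> (real N powr (\<alpha> - 1) / 2) powr (2 * H - 2)"
    using n \<open>0 < N\<close> \<open>H < 1\<close> by (intro powr_mono2') (auto simp: powr_diff field_simps)
  also have "\<dots> = 2 powr (2 - 2 * H) * real N powr (- ((\<alpha> - 1) * (2 - 2 * H)))"
  proof -
    have "(real N powr (\<alpha> - 1) / 2) powr (2 * H - 2)
        = real N powr ((\<alpha> - 1) * (2 * H - 2)) / 2 powr (2 * H - 2)"
      by (simp add: powr_divide powr_powr)
    also have "\<dots> = 2 powr (- (2 * H - 2)) * real N powr ((\<alpha> - 1) * (2 * H - 2))"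
      unfolding powr_minus by (simp add: field_simps)
    also have "(\<alpha> - 1) * (2 * H - 2) = - ((\<alpha> - 1) * (2 - 2 * H))"
      by (simp add: algebra_simps)
    finally show ?thesis by simp
  qed
  finally have rate: "(real N)\<^sup>2 / D \<le> 2 powr (2 - 2 * H) * real N powr (- ((\<alpha> - 1) * (2 - 2 * H)))" .
  have "(\<integral>\<omega>. (drift_mle M B a \<alpha> N \<omega> - a) ^ (2 * k) \<partial>M)
      = (real N / D) ^ (2 * k) * (fact (2 * k) / (2 ^ k * fact k) * D ^ k)"
    unfolding err_X power_mult_distrib by (simp add: moment(2) var_X)
  also have "\<dots> = fact (2 * k) / (2 ^ k * fact k) * ((real N)\<^sup>2 / D) ^ k"
  proof -
    have "(real N / D) ^ (2 * k) * D ^ k = ((real N / D)\<^sup>2 * D) ^ k"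
      by (simp add: power_mult power_mult_distrib)
    also have "(real N / D)\<^sup>2 * D = (real N)\<^sup>2 / D"
      using D by (simp add: power2_eq_square)
    finally show ?thesis by simp
  qed
  also have "\<dots> \<le> fact (2 * k) / (2 ^ k * fact k) *
      (2 powr (2 - 2 * H) * real N powr (- ((\<alpha> - 1) * (2 - 2 * H)))) ^ k"
    using D by (intro mult_left_mono power_mono rate) auto
  finally show "(\<integral>\<omega>. (drift_mle M B a \<alpha> N \<omega> - a) ^ (2 * k) \<partial>M) \<le> fact (2 * k) / (2 ^ k * fact k) *
      (2 powr (2 - 2 * H) * real N powr (- ((\<alpha> - 1) * (2 - 2 * H)))) ^ k" .
qed

theorem proposition2:
  fixes M :: "'a measure" and B :: "real \<Rightarrow> 'a \<Rightarrow> real" and H a \<alpha> :: real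
  assumes "0 < H" and "H < 1"
    and "fractional_brownian_motion M H B"
    and "\<alpha> > 1"
  shows "AE \<omega> in M. (\<lambda>N. drift_mle M B a \<alpha> N \<omega> - a) \<longlonglongrightarrow> 0"
proof -
  define \<beta> where "\<beta> = (\<alpha> - 1) * (2 - 2 * H)"
  have "0 < \<beta>" using assms by (simp add: \<beta>_def)
  \<comment> \<open>The moment of order \<open>2 * k\<close> decays like N to the power -k \<beta>,
    which is summable once \<open>real k * \<beta>\<close> exceeds 1.\<close>
  obtain k :: nat where k: "1 < real k * \<beta>"
    using ex_less_of_nat_mult[OF \<open>0 < \<beta>\<close>] by blast
  define b where "b N = fact (2 * k) / (2 ^ k * fact k) * (2 powr (2 - 2 * H) * real N powr (- \<beta>)) ^ k" for N
  have b: "b N = (fact (2 * k) / (2 ^ k * fact k) * (2 powr (2 - 2 * H)) ^ k) * real N powr (- (real k * \<beta>))"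
    if "0 < N" for N
    using that by (simp add: b_def power_mult_distrib powr_power)
  have "summable (\<lambda>N. real (Suc N) powr (- (real k * \<beta>)))"
    using k by (subst summable_Suc_iff[of "\<lambda>N. real N powr (- (real k * \<beta>))"]) (simp add: summable_real_powr_iff)
  then have "summable (\<lambda>N. b (Suc N))"
    by (simp only: b zero_less_Suc summable_mult)
  moreover have "0 < k" using k by (cases k) auto
  \<comment> \<open>The moment bound assumes \<open>0 < N\<close>, so the criterion is applied to
    the sequence shifted by one, which has the same limit.\<close>
  ultimately have "AE \<omega> in M. (\<lambda>N. drift_mle M B a \<alpha> (Suc N) \<omega> - a) \<longlonglongrightarrow> 0"
    using drift_mle_error_moment[OF assms, of "Suc _" a k]
    by (intro AE_tendsto_zero_if_summable_even_moments[where k = k and b = "\<lambda>N. b (Suc N)"])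
      (auto simp: b_def \<beta>_def)
  then show ?thesis
    by eventually_elim (rule LIMSEQ_imp_Suc)
qed

end
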